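(* Let $e_1<e_2<e_3<e_4$ be distinct reals and consider the reduced ellipsoidal integrable system $(\eta_1,\eta_2):M_h\to\mathbb R^2$ with $2h=1$, where $\eta_1=\sum_{i<j}\ell_{ij}^2\sum_{k\ne i,j}e_k$ and $\eta_2=\sum_{i<j}\ell_{ij}^2\prod_{k\ne i,j}e_k$. The set of critical values is composed of (parts of) four straight lines and a quadratic curve: the lines $\mathcal L_i:\ \eta_2-e_i(\eta_1-e_i)=0$, $i\in\{1,2,3,4\}$, and the part of the parabola $\eta_2=\eta_1^2/4$ given by $\mathcal C:(\eta_1,\eta_2)=(2t,t^2)$, $e_2\le t\le e_3$. There are six transverse intersections $\mathcal L_i\cap\mathcal L_j$ ($i\neq j$), occurring at $d_{ij}=(e_i+e_j,e_ie_j)$, and the points $d_i=(2e_i,e_i^2)$, $i\in\{2,3\}$, are the two tangential intersections of $\mathcal L_2$ and $\mathcal L_3$ with $\mathcal C$.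
   Context: $\mathbf L=(\ell_{12},\ell_{13},\ell_{14},\ell_{23},\ell_{24},\ell_{34})\in\mathbb R^6\cong\mathfrak{so}(4)^*$ with the Lie–Poisson bracket of $\mathfrak{so}(4)$ (extending $\ell_{ji}=-\ell_{ij}$: $\{\ell_{ij},\ell_{jk}\}=-\ell_{ik}$ for distinct $i,j,k$, and $\{\ell_{ij},\ell_{kl}\}=0$ when $\{i,j\}\cap\{k,l\}=\emptyset$). $M_h=\{\mathbf L:\sum_{i<j}\ell_{ij}^2=2h,\ \ell_{12}\ell_{34}-\ell_{13}\ell_{24}+\ell_{14}\ell_{23}=0\}\cong S^2\times S^2$ is a symplectic leaf; this system is the reduction of the geodesic flow on $S^3$ separated in ellipsoidal coordinates. *)

theory Defs
  imports "HOL-Analysis.Analysis"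
begin

text \<open>Coordinates: a vector L :: real^6 encodes
  (l12, l13, l14, l23, l24, l34) = (L$1, L$2, L$3, L$4, L$5, L$6).
  The parameters e_1 < e_2 < e_3 < e_4 are given as e :: nat => real (indices 1..4).\<close>

definition eta1 :: "(nat \<Rightarrow> real) \<Rightarrow> real^6 \<Rightarrow> real" where
  "eta1 e L = (L$1)^2 * (e 3 + e 4) + (L$2)^2 * (e 2 + e 4) + (L$3)^2 * (e 2 + e 3)
            + (L$4)^2 * (e 1 + e 4) + (L$5)^2 * (e 1 + e 3) + (L$6)^2 * (e 1 + e 2)"

definition eta2 :: "(nat \<Rightarrow> real) \<Rightarrow> real^6 \<Rightarrow> real" where
  "eta2 e L = (L$1)^2 * (e 3 * e 4) + (L$2)^2 * (e 2 * e 4) + (L$3)^2 * (e 2 * e 3)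
            + (L$4)^2 * (e 1 * e 4) + (L$5)^2 * (e 1 * e 3) + (L$6)^2 * (e 1 * e 2)"

definition EM :: "(nat \<Rightarrow> real) \<Rightarrow> real^6 \<Rightarrow> real \<times> real" where
  "EM e L = (eta1 e L, eta2 e L)"

definition casimirs :: "real^6 \<Rightarrow> real \<times> real" where
  "casimirs L = ((L$1)^2 + (L$2)^2 + (L$3)^2 + (L$4)^2 + (L$5)^2 + (L$6)^2,
                 L$1 * L$6 - L$2 * L$5 + L$3 * L$4)"

definition Mh :: "(real^6) set" where
  "Mh = casimirs -` {(1, 0)}"

definition tangent_space :: "real^6 \<Rightarrow> (real^6) set" where
  "tangent_space p = {v. frechet_derivative casimirs (at p) v = 0}"

definition critical_point :: "(nat \<Rightarrow> real) \<Rightarrow> real^6 \<Rightarrow> bool" where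
  "critical_point e p \<longleftrightarrow> p \<in> Mh \<and>
     frechet_derivative (EM e) (at p) ` tangent_space p \<noteq> UNIV"

definition critical_values :: "(nat \<Rightarrow> real) \<Rightarrow> (real \<times> real) set" where
  "critical_values e = EM e ` {p. critical_point e p}"

definition Lline :: "(nat \<Rightarrow> real) \<Rightarrow> nat \<Rightarrow> (real \<times> real) set" where
  "Lline e i = {(x, y). y - e i * (x - e i) = 0}"

definition parabola :: "(real \<times> real) set" where
  "parabola = {(x, y). y = x^2 / 4}"

definition Ccurve :: "(nat \<Rightarrow> real) \<Rightarrow> (real \<times> real) set" where
  "Ccurve e = {(2 * t, t^2) | t. e 2 \<le> t \<and> t \<le> e 3}"

end

theory Submission
  imports Defs
begin

text \<open>A critical point p of (\<eta>1, \<eta>2) on M_h satisfies a Lagrange condition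
  a \<nabla>\<eta>1 + b \<nabla>\<eta>2 = c \<nabla>C_1 + d \<nabla>C_2 with (a, b) \<noteq> 0; coordinatewise it couples each
  l_ij with its Hodge dual l_kl, and it puts the image point on the line a \<eta>1 + b \<eta>2 = c.
  Since (\<eta>1, \<eta>2) = \<Sum> l_ij^2 d_kl is a convex combination of the six points d_kl, for d = 0
  the line passes through the d_kl of all active coordinates; the vanishing Pfaffian
  forces two of them to share an index i, and then the line is L_i. For d \<noteq> 0 at least
  two dual pairs are active, and comparing their products shows that the line is tangent
  to the parabola \<eta>2 = \<eta>1^2/4 at some (2t, t^2); the image point is the point of tangency,
  and the sign of \<Prod> (t - e_i) confines t to [e_2, e_3]. Conversely, explicit points of M_h
  realise the curve C, a segment on each L_i and all d_ij.\<close>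

lemma exhaust_6:
  fixes k :: 6
  shows "k = 1 \<or> k = 2 \<or> k = 3 \<or> k = 4 \<or> k = 5 \<or> k = 6"
proof (induct k)
  case (of_int z)
  then have "z = 0 \<or> z = 1 \<or> z = 2 \<or> z = 3 \<or> z = 4 \<or> z = 5" by fastforce
  then show ?case by (elim disjE) simp_all
qed

lemma UNIV_6: "UNIV = {1, 2, 3, 4, 5, 6::6}"
  using exhaust_6 by auto

lemma forall_6: "(\<forall>k::6. P k) \<longleftrightarrow> P 1 \<and> P 2 \<and> P 3 \<and> P 4 \<and> P 5 \<and> P 6"
  by (metis exhaust_6)

lemma distinct_6: "distinct [1, 2, 3, 4, 5, 6::6]"
  by simp

lemma sum_6: "sum f (UNIV::6 set) = f 1 + f 2 + f 3 + f 4 + f 5 + f 6"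
proof -
  have "UNIV = set [1, 2, 3, 4, 5, 6::6]" using UNIV_6 by simp
  then show ?thesis using sum.distinct_set_conv_list[OF distinct_6, of f] by (simp add: add.assoc)
qed

lemma inner_vec6: "x \<bullet> y = x$1 * y$1 + x$2 * y$2 + x$3 * y$3 + x$4 * y$4 + x$5 * y$5 + x$6 * y$6"
  for x y :: "real^6"
  by (simp add: inner_vec_def sum_6)

definition vec6 :: "real \<Rightarrow> real \<Rightarrow> real \<Rightarrow> real \<Rightarrow> real \<Rightarrow> real \<Rightarrow> real^6" where
  "vec6 x1 x2 x3 x4 x5 x6 = (\<chi> k. if k = 1 then x1 else if k = 2 then x2 else if k = 3 then x3
     else if k = 4 then x4 else if k = 5 then x5 else x6)"

lemma vec6_nth [simp]:
  "vec6 x1 x2 x3 x4 x5 x6 $ 1 = x1" "vec6 x1 x2 x3 x4 x5 x6 $ 2 = x2" "vec6 x1 x2 x3 x4 x5 x6 $ 3 = x3"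
  "vec6 x1 x2 x3 x4 x5 x6 $ 4 = x4" "vec6 x1 x2 x3 x4 x5 x6 $ 5 = x5" "vec6 x1 x2 x3 x4 x5 x6 $ 6 = x6"
  by (simp_all add: vec6_def)

definition hodge :: "real^6 \<Rightarrow> real^6" where
  "hodge L = vec6 (L$6) (- L$5) (L$4) (L$3) (- L$2) (L$1)"

text \<open>Coordinate l_ij carries the weight d_kl = (e_k + e_l, e_k e_l) of the complementary pair
  {k, l}, so that (\<eta>1, \<eta>2) = \<Sum> l_ij^2 d_kl.\<close>
definition pair_sum :: "(nat \<Rightarrow> real) \<Rightarrow> real^6" where
  "pair_sum e = vec6 (e 3 + e 4) (e 2 + e 4) (e 2 + e 3) (e 1 + e 4) (e 1 + e 3) (e 1 + e 2)"

definition pair_prod :: "(nat \<Rightarrow> real) \<Rightarrow> real^6" where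
  "pair_prod e = vec6 (e 3 * e 4) (e 2 * e 4) (e 2 * e 3) (e 1 * e 4) (e 1 * e 3) (e 1 * e 2)"

lemma eta1_eq_inner: "eta1 e L = L \<bullet> (pair_sum e * L)"
  by (simp add: eta1_def inner_vec6 pair_sum_def power2_eq_square ac_simps)

lemma eta2_eq_inner: "eta2 e L = L \<bullet> (pair_prod e * L)"
  by (simp add: eta2_def inner_vec6 pair_prod_def power2_eq_square ac_simps)

lemma casimirs_eq_inner: "casimirs L = (L \<bullet> L, (L \<bullet> hodge L) / 2)"
  by (simp add: casimirs_def inner_vec6 hodge_def power2_eq_square algebra_simps)

lemma inner_hodge_commute: "hodge x \<bullet> y = x \<bullet> hodge y"
  by (simp add: inner_vec6 hodge_def algebra_simps)

lemma inner_hodge_hodge: "hodge x \<bullet> hodge x = x \<bullet> x"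
  by (simp add: inner_vec6 hodge_def algebra_simps)

lemma bounded_linear_vector_times: "bounded_linear (\<lambda>v::real^'n. w * v)"
  by (rule linear_conv_bounded_linear[THEN iffD1], rule linearI) (simp_all add: vec_eq_iff distrib_left)

lemma inner_vector_times_commute: "x \<bullet> (w * y) = (w * x) \<bullet> y"
  for x y w :: "real^'n"
  by (simp add: inner_vec_def mult_ac)

lemma has_derivative_quadratic:
  fixes w :: "real^'n"
  shows "((\<lambda>L. L \<bullet> (w * L)) has_derivative (\<lambda>v. 2 * ((w * p) \<bullet> v))) (at p)"
proof -
  have "((\<lambda>L. L \<bullet> (w * L)) has_derivative (\<lambda>v. p \<bullet> (w * v) + v \<bullet> (w * p))) (at p)"
    by (rule has_derivative_inner[OF has_derivative_ident
          bounded_linear_imp_has_derivative[OF bounded_linear_vector_times]])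
  moreover have "p \<bullet> (w * v) + v \<bullet> (w * p) = 2 * ((w * p) \<bullet> v)" for v
    using inner_vector_times_commute[of p w v] inner_commute[of v "w * p"] by simp
  ultimately show ?thesis by simp
qed

lemma bounded_linear_hodge: "bounded_linear hodge"
  by (rule linear_conv_bounded_linear[THEN iffD1], rule linearI)
     (simp_all add: vec_eq_iff forall_6 hodge_def)

lemma has_derivative_hodge [derivative_intros]: "(hodge has_derivative hodge) F"
  by (rule bounded_linear_imp_has_derivative[OF bounded_linear_hodge])

lemma has_derivative_casimirs:
  "(casimirs has_derivative (\<lambda>v. (2 * (p \<bullet> v), hodge p \<bullet> v))) (at p)"
proof -
  have "casimirs = (\<lambda>L. (L \<bullet> L, (L \<bullet> hodge L) / 2))"
    using casimirs_eq_inner by blast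
  moreover have "((\<lambda>L. (L \<bullet> L, (L \<bullet> hodge L) / 2)) has_derivative
      (\<lambda>v. (p \<bullet> v + v \<bullet> p, (p \<bullet> hodge v + v \<bullet> hodge p) / 2))) (at p)"
    by (intro derivative_eq_intros) auto
  moreover have "p \<bullet> hodge v + v \<bullet> hodge p = 2 * (hodge p \<bullet> v)" for v
    by (metis inner_commute inner_hodge_commute mult_2)
  ultimately show ?thesis
    by (simp add: inner_commute)
qed

lemma has_derivative_EM:
  "(EM e has_derivative (\<lambda>v. (2 * ((pair_sum e * p) \<bullet> v), 2 * ((pair_prod e * p) \<bullet> v)))) (at p)"
proof -
  have "EM e = (\<lambda>L. (L \<bullet> (pair_sum e * L), L \<bullet> (pair_prod e * L)))"
    by (simp add: fun_eq_iff EM_def eta1_eq_inner eta2_eq_inner)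
  then show ?thesis
    by (simp add: has_derivative_Pair has_derivative_quadratic)
qed

lemma Mh_iff: "p \<in> Mh \<longleftrightarrow> p \<bullet> p = 1 \<and> p \<bullet> hodge p = 0"
  by (simp add: Mh_def casimirs_eq_inner)

lemma tangent_space_eq: "tangent_space p = {v. p \<bullet> v = 0 \<and> hodge p \<bullet> v = 0}"
  by (simp add: tangent_space_def frechet_derivative_at[OF has_derivative_casimirs, symmetric]
      zero_prod_def)

lemma linear_image_neq_UNIV_iff:
  fixes D :: "'a::euclidean_space \<Rightarrow> 'b::euclidean_space"
  assumes "linear D" and "subspace T"
  shows "D ` T \<noteq> UNIV \<longleftrightarrow> (\<exists>c. c \<noteq> 0 \<and> (\<forall>v\<in>T. c \<bullet> D v = 0))"
proof
  assume "D ` T \<noteq> UNIV"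
  moreover have "span (D ` T) = D ` T"
    using assms by (simp add: linear_subspace_image)
  ultimately obtain c where "c \<noteq> 0" "D ` T \<subseteq> {x. c \<bullet> x = 0}"
    using span_not_univ_subset_hyperplane by metis
  then show "\<exists>c. c \<noteq> 0 \<and> (\<forall>v\<in>T. c \<bullet> D v = 0)" by auto
next
  assume "\<exists>c. c \<noteq> 0 \<and> (\<forall>v\<in>T. c \<bullet> D v = 0)"
  then obtain c where "c \<noteq> 0" "\<forall>v\<in>T. c \<bullet> D v = 0" by blast
  then have "c \<notin> D ` T" by auto
  then show "D ` T \<noteq> UNIV" by blast
qed

lemma orthonormal_pair_complement:
  fixes g u w :: "'a::real_inner"
  assumes "u \<bullet> u = 1" "w \<bullet> w = 1" "u \<bullet> w = 0"
    and "\<And>v. u \<bullet> v = 0 \<Longrightarrow> w \<bullet> v = 0 \<Longrightarrow> g \<bullet> v = 0"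
  shows "g = (g \<bullet> u) *\<^sub>R u + (g \<bullet> w) *\<^sub>R w"
proof -
  define r where "r = g - (g \<bullet> u) *\<^sub>R u - (g \<bullet> w) *\<^sub>R w"
  have "u \<bullet> r = 0" "w \<bullet> r = 0"
    using assms(1-3) by (simp_all add: r_def inner_diff_right inner_commute)
  moreover have "r \<bullet> r = g \<bullet> r - (g \<bullet> u) * (u \<bullet> r) - (g \<bullet> w) * (w \<bullet> r)"
    by (simp add: r_def inner_diff_left)
  ultimately have "r = 0" using assms(4) by simp
  then show ?thesis by (simp add: r_def algebra_simps)
qed

lemma orthogonal_tangent_space_iff:
  assumes "p \<in> Mh"
  shows "(\<forall>v\<in>tangent_space p. g \<bullet> v = 0) \<longleftrightarrow> (\<exists>c d. g = c *\<^sub>R p + d *\<^sub>R hodge p)"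
proof
  assume "\<forall>v\<in>tangent_space p. g \<bullet> v = 0"
  moreover have "p \<bullet> p = 1" "hodge p \<bullet> hodge p = 1" "p \<bullet> hodge p = 0"
    using assms by (simp_all add: Mh_iff inner_hodge_hodge)
  ultimately have "g = (g \<bullet> p) *\<^sub>R p + (g \<bullet> hodge p) *\<^sub>R hodge p"
    by (intro orthonormal_pair_complement) (auto simp: tangent_space_eq)
  then show "\<exists>c d. g = c *\<^sub>R p + d *\<^sub>R hodge p" by blast
qed (auto simp: tangent_space_eq inner_add_left)

lemma critical_point_iff:
  "critical_point e p \<longleftrightarrow> p \<in> Mh \<and> (\<exists>a b c d. (a, b) \<noteq> 0 \<and>
     a *\<^sub>R (pair_sum e * p) + b *\<^sub>R (pair_prod e * p) = c *\<^sub>R p + d *\<^sub>R hodge p)"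
proof -
  define D where "D = (\<lambda>v. (2 * ((pair_sum e * p) \<bullet> v), 2 * ((pair_prod e * p) \<bullet> v)))"
  define g where "g = (\<lambda>a b. a *\<^sub>R (pair_sum e * p) + b *\<^sub>R (pair_prod e * p))"
  have "(EM e has_derivative D) (at p)"
    unfolding D_def by (rule has_derivative_EM)
  then have D: "frechet_derivative (EM e) (at p) = D" "linear D"
    by (auto simp: frechet_derivative_at[symmetric] has_derivative_linear)
  have "subspace (tangent_space p)"
    unfolding tangent_space_eq Collect_conj_eq by (intro subspace_inter subspace_hyperplane)
  then have "critical_point e p \<longleftrightarrow>
      p \<in> Mh \<and> (\<exists>ab. ab \<noteq> 0 \<and> (\<forall>v\<in>tangent_space p. ab \<bullet> D v = 0))"
    unfolding critical_point_def D(1) using linear_image_neq_UNIV_iff[OF D(2)] by blast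
  also have "\<dots> \<longleftrightarrow> p \<in> Mh \<and> (\<exists>a b. (a, b) \<noteq> 0 \<and> (\<forall>v\<in>tangent_space p. g a b \<bullet> v = 0))"
  proof -
    have "(a, b) \<bullet> D v = 2 * (g a b \<bullet> v)" for a b v
      by (simp add: D_def g_def inner_add_left algebra_simps)
    then show ?thesis by (simp add: split_paired_Ex)
  qed
  finally show ?thesis
    using orthogonal_tangent_space_iff unfolding g_def by blast
qed

lemma product_eq_square_if_swapped:
  fixes F G x y d :: real
  assumes "F * x = d * y" "G * y = d * x" "x \<noteq> 0"
  shows "F * G = d\<^sup>2"
proof -
  have "(F * G) * x = d\<^sup>2 * x"
    using assms(1,2) by (metis mult.assoc mult.commute power2_eq_square)
  then show ?thesis using assms(3) by simp
qed

lemma zero_iff_if_swapped: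
  fixes F G x y d :: real
  assumes "F * x = d * y" "G * y = d * x" "d \<noteq> 0"
  shows "x = 0 \<longleftrightarrow> y = 0"
  using assms by auto

lemma quartic_pos_cases:
  fixes x1 x2 x3 x4 t :: real
  assumes "x1 < x2" "x2 < x3" "x3 < x4" and "0 < (x1 - t) * (x2 - t) * (x3 - t) * (x4 - t)"
  shows "t < x1 \<or> x2 < t \<and> t < x3 \<or> x4 < t"
proof (rule ccontr)
  assume "\<not> ?thesis"
  then have "x1 \<le> t \<and> t \<le> x2 \<or> x3 \<le> t \<and> t \<le> x4" by linarith
  then have "(x1 - t) * (x2 - t) * (x3 - t) * (x4 - t) \<le> 0"
  proof
    assume "x1 \<le> t \<and> t \<le> x2"
    then have "(x1 - t) * (x2 - t) \<le> 0" "0 \<le> (x3 - t) * (x4 - t)"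
      using assms(2,3) by (auto intro: mult_nonpos_nonneg)
    then show ?thesis by (metis mult.assoc mult_nonpos_nonneg)
  next
    assume "x3 \<le> t \<and> t \<le> x4"
    then have "0 \<le> (x1 - t) * (x2 - t)" "(x3 - t) * (x4 - t) \<le> 0"
      using assms(1,2) by (auto intro: mult_nonpos_nonpos mult_nonpos_nonneg)
    then show ?thesis by (metis mult.assoc mult_nonneg_nonpos)
  qed
  then show False using assms(4) by simp
qed

locale lagrange_point =
  fixes e :: "nat \<Rightarrow> real" and p :: "real^6" and a b c d :: real
  assumes e_less: "e 1 < e 2" "e 2 < e 3" "e 3 < e 4"
    and on_leaf: "p \<in> Mh"
    and multipliers_nonzero: "(a, b) \<noteq> 0"
    and lagrange: "a *\<^sub>R (pair_sum e * p) + b *\<^sub>R (pair_prod e * p) = c *\<^sub>R p + d *\<^sub>R hodge p"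
begin

definition lagrange_form :: "real \<Rightarrow> real \<Rightarrow> real" where
  "lagrange_form x y = a * (x + y) + b * (x * y) - c"

lemma lagrange_form_commute: "lagrange_form x y = lagrange_form y x"
  by (simp add: lagrange_form_def ac_simps)

lemma lagrange_coords:
  "lagrange_form (e 3) (e 4) * p$1 = d * p$6"
  "lagrange_form (e 2) (e 4) * p$2 = - d * p$5"
  "lagrange_form (e 2) (e 3) * p$3 = d * p$4"
  "lagrange_form (e 1) (e 4) * p$4 = d * p$3"
  "lagrange_form (e 1) (e 3) * p$5 = - d * p$2"
  "lagrange_form (e 1) (e 2) * p$6 = d * p$1"
proof -
  have "\<forall>k. (a *\<^sub>R (pair_sum e * p) + b *\<^sub>R (pair_prod e * p)) $ k = (c *\<^sub>R p + d *\<^sub>R hodge p) $ k"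
    using lagrange by simp
  then show
    "lagrange_form (e 3) (e 4) * p$1 = d * p$6"
    "lagrange_form (e 2) (e 4) * p$2 = - d * p$5"
    "lagrange_form (e 2) (e 3) * p$3 = d * p$4"
    "lagrange_form (e 1) (e 4) * p$4 = d * p$3"
    "lagrange_form (e 1) (e 3) * p$5 = - d * p$2"
    "lagrange_form (e 1) (e 2) * p$6 = d * p$1"
    by (simp_all add: forall_6 lagrange_form_def pair_sum_def pair_prod_def hodge_def algebra_simps)
qed

lemma sum_squares_eq_1: "(p$1)\<^sup>2 + (p$2)\<^sup>2 + (p$3)\<^sup>2 + (p$4)\<^sup>2 + (p$5)\<^sup>2 + (p$6)\<^sup>2 = 1"
  using on_leaf by (simp add: Mh_def casimirs_def)

lemma pfaffian_eq_0: "p$1 * p$6 - p$2 * p$5 + p$3 * p$4 = 0"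
  using on_leaf by (simp add: Mh_def casimirs_def)

lemma EM_on_multiplier_line: "a * eta1 e p + b * eta2 e p = c"
proof -
  have "a * eta1 e p + b * eta2 e p = p \<bullet> (a *\<^sub>R (pair_sum e * p) + b *\<^sub>R (pair_prod e * p))"
    by (simp add: eta1_eq_inner eta2_eq_inner inner_add_right)
  also have "\<dots> = c * (p \<bullet> p) + d * (p \<bullet> hodge p)"
    by (simp add: lagrange inner_add_right)
  finally show ?thesis using on_leaf by (simp add: Mh_iff)
qed

lemma EM_in_Lline_if_two_roots:
  assumes "lagrange_form (e i) y1 = 0" "lagrange_form (e i) y2 = 0" "y1 \<noteq> y2"
  shows "EM e p \<in> Lline e i"
proof -
  have "(a + b * e i) * (y1 - y2) = 0"
    using assms(1,2) by (simp add: lagrange_form_def algebra_simps)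
  then have a: "a = - b * e i" using assms(3) by simp
  then have c: "c = - b * (e i)\<^sup>2"
    using assms(1) unfolding lagrange_form_def by (simp add: algebra_simps power2_eq_square)
  have "b \<noteq> 0" using a multipliers_nonzero by (auto simp: zero_prod_def)
  moreover have "b * (eta2 e p - e i * (eta1 e p - e i)) = 0"
    using EM_on_multiplier_line by (simp add: a c algebra_simps power2_eq_square)
  ultimately show ?thesis by (simp add: EM_def Lline_def)
qed

lemma EM_in_Lline_if_d_zero:
  assumes "d = 0"
  shows "\<exists>i\<in>{1..4}. EM e p \<in> Lline e i"
proof -
  text \<open>Two active coordinates outside a dual pair have weights d_ij, d_ik on a common L_i,
    which then is the multiplier line. Otherwise the support is a single coordinate,
    whose weight lies on some L_i, or a dual pair, which the vanishing Pfaffian excludes.\<close>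
  have root:
    "p$1 \<noteq> 0 \<Longrightarrow> lagrange_form (e 3) (e 4) = 0" "p$2 \<noteq> 0 \<Longrightarrow> lagrange_form (e 2) (e 4) = 0"
    "p$3 \<noteq> 0 \<Longrightarrow> lagrange_form (e 2) (e 3) = 0" "p$4 \<noteq> 0 \<Longrightarrow> lagrange_form (e 1) (e 4) = 0"
    "p$5 \<noteq> 0 \<Longrightarrow> lagrange_form (e 1) (e 3) = 0" "p$6 \<noteq> 0 \<Longrightarrow> lagrange_form (e 1) (e 2) = 0"
    using lagrange_coords assms by simp_all
  have e_ne: "e 1 \<noteq> e 2" "e 1 \<noteq> e 3" "e 1 \<noteq> e 4" "e 2 \<noteq> e 3" "e 2 \<noteq> e 4" "e 3 \<noteq> e 4"
    using e_less by linarith+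
  note two_roots = EM_in_Lline_if_two_roots[OF _ _ not_sym] EM_in_Lline_if_two_roots
  have L1: "p$4 \<noteq> 0 \<and> p$5 \<noteq> 0 \<or> p$4 \<noteq> 0 \<and> p$6 \<noteq> 0 \<or> p$5 \<noteq> 0 \<and> p$6 \<noteq> 0 \<Longrightarrow> EM e p \<in> Lline e 1"
    using root e_ne two_roots[of 1] by blast
  have L2: "p$2 \<noteq> 0 \<and> p$3 \<noteq> 0 \<or> p$2 \<noteq> 0 \<and> p$6 \<noteq> 0 \<or> p$3 \<noteq> 0 \<and> p$6 \<noteq> 0 \<Longrightarrow> EM e p \<in> Lline e 2"
    using root e_ne two_roots[of 2] lagrange_form_commute by metis
  have L3: "p$1 \<noteq> 0 \<and> p$3 \<noteq> 0 \<or> p$1 \<noteq> 0 \<and> p$5 \<noteq> 0 \<or> p$3 \<noteq> 0 \<and> p$5 \<noteq> 0 \<Longrightarrow> EM e p \<in> Lline e 3"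
    using root e_ne two_roots[of 3] lagrange_form_commute by metis
  have L4: "p$1 \<noteq> 0 \<and> p$2 \<noteq> 0 \<or> p$1 \<noteq> 0 \<and> p$4 \<noteq> 0 \<or> p$2 \<noteq> 0 \<and> p$4 \<noteq> 0 \<Longrightarrow> EM e p \<in> Lline e 4"
    using root e_ne two_roots[of 4] lagrange_form_commute by metis
  have single:
    "p$2 = 0 \<Longrightarrow> p$3 = 0 \<Longrightarrow> p$4 = 0 \<Longrightarrow> p$5 = 0 \<Longrightarrow> p$6 = 0 \<Longrightarrow> EM e p \<in> Lline e 3"
    "p$1 = 0 \<Longrightarrow> p$3 = 0 \<Longrightarrow> p$4 = 0 \<Longrightarrow> p$5 = 0 \<Longrightarrow> p$6 = 0 \<Longrightarrow> EM e p \<in> Lline e 2"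
    "p$1 = 0 \<Longrightarrow> p$2 = 0 \<Longrightarrow> p$4 = 0 \<Longrightarrow> p$5 = 0 \<Longrightarrow> p$6 = 0 \<Longrightarrow> EM e p \<in> Lline e 2"
    "p$1 = 0 \<Longrightarrow> p$2 = 0 \<Longrightarrow> p$3 = 0 \<Longrightarrow> p$5 = 0 \<Longrightarrow> p$6 = 0 \<Longrightarrow> EM e p \<in> Lline e 1"
    "p$1 = 0 \<Longrightarrow> p$2 = 0 \<Longrightarrow> p$3 = 0 \<Longrightarrow> p$4 = 0 \<Longrightarrow> p$6 = 0 \<Longrightarrow> EM e p \<in> Lline e 1"
    "p$1 = 0 \<Longrightarrow> p$2 = 0 \<Longrightarrow> p$3 = 0 \<Longrightarrow> p$4 = 0 \<Longrightarrow> p$5 = 0 \<Longrightarrow> EM e p \<in> Lline e 1"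
    using sum_squares_eq_1 by (simp_all add: EM_def eta1_def eta2_def Lline_def algebra_simps)
  have block:
    "p$2 = 0 \<Longrightarrow> p$3 = 0 \<Longrightarrow> p$4 = 0 \<Longrightarrow> p$5 = 0 \<Longrightarrow> p$1 = 0 \<or> p$6 = 0"
    "p$1 = 0 \<Longrightarrow> p$3 = 0 \<Longrightarrow> p$4 = 0 \<Longrightarrow> p$6 = 0 \<Longrightarrow> p$2 = 0 \<or> p$5 = 0"
    "p$1 = 0 \<Longrightarrow> p$2 = 0 \<Longrightarrow> p$5 = 0 \<Longrightarrow> p$6 = 0 \<Longrightarrow> p$3 = 0 \<or> p$4 = 0"
    using pfaffian_eq_0 by simp_all
  have "\<not> (p$1 = 0 \<and> p$2 = 0 \<and> p$3 = 0 \<and> p$4 = 0 \<and> p$5 = 0 \<and> p$6 = 0)"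
    using sum_squares_eq_1 by auto
  then have "EM e p \<in> Lline e 1 \<or> EM e p \<in> Lline e 2 \<or> EM e p \<in> Lline e 3 \<or> EM e p \<in> Lline e 4"
    using L1 L2 L3 L4 single block by argo
  then show ?thesis by force
qed

lemma blocks_paired:
  assumes "d \<noteq> 0"
  shows "p$1 = 0 \<longleftrightarrow> p$6 = 0" "p$2 = 0 \<longleftrightarrow> p$5 = 0" "p$3 = 0 \<longleftrightarrow> p$4 = 0"
  using zero_iff_if_swapped[OF lagrange_coords(1) lagrange_coords(6)]
    zero_iff_if_swapped[OF lagrange_coords(2) lagrange_coords(5)]
    zero_iff_if_swapped[OF lagrange_coords(3) lagrange_coords(4)] assms by simp_all

lemma block_products:
  "p$1 \<noteq> 0 \<Longrightarrow> lagrange_form (e 3) (e 4) * lagrange_form (e 1) (e 2) = d\<^sup>2"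
  "p$2 \<noteq> 0 \<Longrightarrow> lagrange_form (e 2) (e 4) * lagrange_form (e 1) (e 3) = d\<^sup>2"
  "p$3 \<noteq> 0 \<Longrightarrow> lagrange_form (e 2) (e 3) * lagrange_form (e 1) (e 4) = d\<^sup>2"
  using product_eq_square_if_swapped[OF lagrange_coords(1) lagrange_coords(6)]
    product_eq_square_if_swapped[OF lagrange_coords(2) lagrange_coords(5)]
    product_eq_square_if_swapped[OF lagrange_coords(3) lagrange_coords(4)] by simp_all

lemma weighted_sum_eq_0:
  "lagrange_form (e 3) (e 4) * (p$1)\<^sup>2 + lagrange_form (e 2) (e 4) * (p$2)\<^sup>2
     + lagrange_form (e 2) (e 3) * (p$3)\<^sup>2 = 0"
proof -
  have "lagrange_form (e 3) (e 4) * (p$1)\<^sup>2 + lagrange_form (e 2) (e 4) * (p$2)\<^sup>2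
      + lagrange_form (e 2) (e 3) * (p$3)\<^sup>2 = d * (p$1 * p$6 - p$2 * p$5 + p$3 * p$4)"
    using lagrange_coords(1-3) by (simp add: power2_eq_square algebra_simps)
  then show ?thesis using pfaffian_eq_0 by simp
qed

lemma two_blocks_active:
  assumes "d \<noteq> 0"
  shows "p$1 \<noteq> 0 \<and> p$2 \<noteq> 0 \<or> p$1 \<noteq> 0 \<and> p$3 \<noteq> 0 \<or> p$2 \<noteq> 0 \<and> p$3 \<noteq> 0"
proof -
  have "p$1 \<noteq> 0 \<or> p$2 \<noteq> 0 \<or> p$3 \<noteq> 0"
    using sum_squares_eq_1 blocks_paired[OF assms] by auto
  moreover have "lagrange_form (e 3) (e 4) \<noteq> 0" if "p$1 \<noteq> 0"
    using that lagrange_coords(1) blocks_paired[OF assms] assms by auto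
  moreover have "lagrange_form (e 2) (e 4) \<noteq> 0" if "p$2 \<noteq> 0"
    using that lagrange_coords(2) blocks_paired[OF assms] assms by auto
  moreover have "lagrange_form (e 2) (e 3) \<noteq> 0" if "p$3 \<noteq> 0"
    using that lagrange_coords(3) blocks_paired[OF assms] assms by auto
  ultimately show ?thesis using weighted_sum_eq_0 by auto
qed

lemma lagrange_form_exchange:
  "lagrange_form w x * lagrange_form y z - lagrange_form w y * lagrange_form x z
     = - (a\<^sup>2 + b * c) * (w - z) * (x - y)"
  by (simp add: lagrange_form_def algebra_simps power2_eq_square)

text \<open>The multiplier line a \<eta>1 + b \<eta>2 = c is tangent to the parabola \<eta>2 = \<eta>1^2/4.\<close>
lemma multiplier_line_tangent:
  assumes "d \<noteq> 0"
  shows "a\<^sup>2 + b * c = 0"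
proof -
  let ?F = lagrange_form
  have ne: "(e 1 - e 4) * (e 2 - e 3) \<noteq> 0" "(e 1 - e 3) * (e 2 - e 4) \<noteq> 0" "(e 1 - e 2) * (e 3 - e 4) \<noteq> 0"
    using e_less by auto
  have exch:
    "?F (e 3) (e 4) * ?F (e 1) (e 2) - ?F (e 2) (e 4) * ?F (e 1) (e 3) = - (a\<^sup>2 + b * c) * ((e 1 - e 4) * (e 2 - e 3))"
    "?F (e 3) (e 4) * ?F (e 1) (e 2) - ?F (e 2) (e 3) * ?F (e 1) (e 4) = - (a\<^sup>2 + b * c) * ((e 1 - e 3) * (e 2 - e 4))"
    "?F (e 2) (e 4) * ?F (e 1) (e 3) - ?F (e 2) (e 3) * ?F (e 1) (e 4) = - (a\<^sup>2 + b * c) * ((e 1 - e 2) * (e 3 - e 4))"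
    using lagrange_form_exchange[of "e 1" "e 2" "e 3" "e 4"] lagrange_form_exchange[of "e 1" "e 2" "e 4" "e 3"]
      lagrange_form_exchange[of "e 1" "e 3" "e 4" "e 2"]
    by (simp_all add: lagrange_form_commute[of "e 4"] lagrange_form_commute[of "e 3" "e 2"] mult.commute)
  from two_blocks_active[OF assms]
  consider "p$1 \<noteq> 0" "p$2 \<noteq> 0" | "p$1 \<noteq> 0" "p$3 \<noteq> 0" | "p$2 \<noteq> 0" "p$3 \<noteq> 0" by blast
  then show ?thesis
  proof cases
    case 1 then show ?thesis using exch(1) ne(1) block_products by simp
  next
    case 2 then show ?thesis using exch(2) ne(2) block_products by simp
  next
    case 3 then show ?thesis using exch(3) ne(3) block_products by simp
  qed
qed

lemma tangent_parameter:
  assumes "d \<noteq> 0"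
  obtains t where "b \<noteq> 0" and "\<And>x y. lagrange_form x y = b * ((x - t) * (y - t))"
proof
  have tangent: "a\<^sup>2 + b * c = 0" using multiplier_line_tangent[OF assms] .
  then show "b \<noteq> 0" using multipliers_nonzero by (auto simp: zero_prod_def)
  then have "c = - b * (a / b)\<^sup>2"
    using tangent by (simp add: field_simps power2_eq_square)
  then show "lagrange_form x y = b * ((x - (- a / b)) * (y - (- a / b)))" for x y
    using \<open>b \<noteq> 0\<close> by (simp add: lagrange_form_def field_simps power2_eq_square)
qed

lemma tangent_parameter_between:
  assumes "d \<noteq> 0" "b \<noteq> 0" and factor: "\<And>x y. lagrange_form x y = b * ((x - t) * (y - t))"
  shows "e 2 < t \<and> t < e 3"
proof -
  have "b\<^sup>2 * ((e 1 - t) * (e 2 - t) * (e 3 - t) * (e 4 - t)) = d\<^sup>2"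
    using two_blocks_active[OF assms(1)] block_products unfolding factor
    by (auto simp: power2_eq_square algebra_simps)
  then have "0 < b\<^sup>2 * ((e 1 - t) * (e 2 - t) * (e 3 - t) * (e 4 - t))"
    using assms(1) by simp
  then have "0 < (e 1 - t) * (e 2 - t) * (e 3 - t) * (e 4 - t)"
    by (simp add: zero_less_mult_iff)
  then have "t < e 1 \<or> e 2 < t \<and> t < e 3 \<or> e 4 < t"
    using quartic_pos_cases e_less by blast
  moreover have False if "t < e 1 \<or> e 4 < t"
  proof -
    have pos: "0 < (e 3 - t) * (e 4 - t)" "0 < (e 2 - t) * (e 4 - t)" "0 < (e 2 - t) * (e 3 - t)"
      using that e_less by (auto intro: mult_pos_pos mult_neg_neg)
    have "b * ((e 3 - t) * (e 4 - t) * (p$1)\<^sup>2 + (e 2 - t) * (e 4 - t) * (p$2)\<^sup>2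
        + (e 2 - t) * (e 3 - t) * (p$3)\<^sup>2) = 0"
      using weighted_sum_eq_0 unfolding factor by (simp add: algebra_simps)
    then have "(e 3 - t) * (e 4 - t) * (p$1)\<^sup>2 + (e 2 - t) * (e 4 - t) * (p$2)\<^sup>2
        + (e 2 - t) * (e 3 - t) * (p$3)\<^sup>2 = 0"
      using assms(2) by simp
    with pos have "p$1 = 0" "p$2 = 0" "p$3 = 0"
      by (smt (verit) mult_pos_pos zero_le_power2 zero_less_power2 mult_nonneg_nonneg)+
    then show False using two_blocks_active[OF assms(1)] by simp
  qed
  ultimately show ?thesis by blast
qed

lemma EM_eq_tangent_point:
  assumes "d \<noteq> 0" "b \<noteq> 0" and factor: "\<And>x y. lagrange_form x y = b * ((x - t) * (y - t))"
  shows "EM e p = (2 * t, t\<^sup>2)"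
proof -
  have "a = - b * t" "c = - b * t\<^sup>2"
    using factor[of 1 0] factor[of 0 0] by (simp_all add: lagrange_form_def algebra_simps power2_eq_square)
  then have "b * (eta2 e p - (t * eta1 e p - t\<^sup>2)) = 0"
    using EM_on_multiplier_line by (simp add: algebra_simps)
  then have eta2: "eta2 e p = t * eta1 e p - t\<^sup>2"
    using assms(2) by simp
  have dp: "d * p$1 = b * ((e 1 - t) * (e 2 - t)) * p$6" "d * p$6 = b * ((e 3 - t) * (e 4 - t)) * p$1"
    "d * p$2 = - (b * ((e 1 - t) * (e 3 - t)) * p$5)" "d * p$5 = - (b * ((e 2 - t) * (e 4 - t)) * p$2)"
    "d * p$3 = b * ((e 1 - t) * (e 4 - t)) * p$4" "d * p$4 = b * ((e 2 - t) * (e 3 - t)) * p$3"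
    using lagrange_coords unfolding factor by simp_all
  text \<open>d (2t - \<eta>1) is b P'(t) times the Pfaffian, where P(t) = \<Prod> (t - e_i): each dual pair
    contributes the same symmetric expression P'(t).\<close>
  let ?q = "\<lambda>x y. 2 * t - (x + y)"
  have "d * (2 * t - eta1 e p) = ?q (e 3) (e 4) * p$1 * (d * p$1) + ?q (e 2) (e 4) * p$2 * (d * p$2)
      + ?q (e 2) (e 3) * p$3 * (d * p$3) + ?q (e 1) (e 4) * p$4 * (d * p$4)
      + ?q (e 1) (e 3) * p$5 * (d * p$5) + ?q (e 1) (e 2) * p$6 * (d * p$6)"
    using sum_squares_eq_1 unfolding eta1_def by algebra
  also have "\<dots> = b * (4 * t^3 - 3 * t\<^sup>2 * (e 1 + e 2 + e 3 + e 4)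
      + 2 * t * (e 1 * e 2 + e 1 * e 3 + e 1 * e 4 + e 2 * e 3 + e 2 * e 4 + e 3 * e 4)
      - (e 1 * e 2 * e 3 + e 1 * e 2 * e 4 + e 1 * e 3 * e 4 + e 2 * e 3 * e 4))
      * (p$1 * p$6 - p$2 * p$5 + p$3 * p$4)"
    unfolding dp by algebra
  finally have "eta1 e p = 2 * t"
    using pfaffian_eq_0 assms(1) by simp
  with eta2 show ?thesis
    by (simp add: EM_def power2_eq_square)
qed

lemma EM_mem_critical_locus: "EM e p \<in> (\<Union>i\<in>{1..4}. Lline e i) \<union> Ccurve e"
proof (cases "d = 0")
  case True
  then show ?thesis using EM_in_Lline_if_d_zero by blast
next
  case False
  obtain t where "b \<noteq> 0" and factor: "\<And>x y. lagrange_form x y = b * ((x - t) * (y - t))"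
    using tangent_parameter[OF False] by blast
  have "EM e p = (2 * t, t\<^sup>2)"
    by (rule EM_eq_tangent_point[OF False \<open>b \<noteq> 0\<close> factor])
  moreover have "e 2 < t \<and> t < e 3"
    by (rule tangent_parameter_between[OF False \<open>b \<noteq> 0\<close> factor])
  ultimately show ?thesis unfolding Ccurve_def by auto
qed

end

lemma critical_values_subset:
  assumes "e 1 < e 2" "e 2 < e 3" "e 3 < e 4"
  shows "critical_values e \<subseteq> (\<Union>i\<in>{1..4}. Lline e i) \<union> Ccurve e"
proof
  fix z assume "z \<in> critical_values e"
  then obtain p where "critical_point e p" "z = EM e p"
    by (auto simp: critical_values_def)
  then obtain a b c d where "p \<in> Mh" "(a, b) \<noteq> 0"
    "a *\<^sub>R (pair_sum e * p) + b *\<^sub>R (pair_prod e * p) = c *\<^sub>R p + d *\<^sub>R hodge p"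
    unfolding critical_point_iff by blast
  then interpret lagrange_point e p a b c d
    using assms by unfold_locales
  show "z \<in> (\<Union>i\<in>{1..4}. Lline e i) \<union> Ccurve e"
    using EM_mem_critical_locus \<open>z = EM e p\<close> by simp
qed

lemma critical_point_if_support_on_line:
  assumes "p \<in> Mh" "(a, b) \<noteq> 0"
    and "\<And>k. p$k \<noteq> 0 \<Longrightarrow> a * pair_sum e $ k + b * pair_prod e $ k = c"
  shows "critical_point e p" and "a * eta1 e p + b * eta2 e p = c"
proof -
  have "(a * pair_sum e $ k + b * pair_prod e $ k) * p$k = c * p$k" for k
    using assms(3) by (cases "p$k = 0") auto
  then have lagrange: "a *\<^sub>R (pair_sum e * p) + b *\<^sub>R (pair_prod e * p) = c *\<^sub>R p"
    by (simp add: vec_eq_iff algebra_simps)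
  then have "a *\<^sub>R (pair_sum e * p) + b *\<^sub>R (pair_prod e * p) = c *\<^sub>R p + 0 *\<^sub>R hodge p"
    by simp
  then show "critical_point e p"
    unfolding critical_point_iff using assms(1,2) by blast
  have "a * eta1 e p + b * eta2 e p = p \<bullet> (a *\<^sub>R (pair_sum e * p) + b *\<^sub>R (pair_prod e * p))"
    by (simp add: eta1_eq_inner eta2_eq_inner inner_add_right)
  then show "a * eta1 e p + b * eta2 e p = c"
    using assms(1) by (simp add: lagrange Mh_iff)
qed

lemma weight_critical_value: "(pair_sum e $ k, pair_prod e $ k) \<in> critical_values e"
proof -
  have "hodge (axis k 1) $ k = 0"
    using exhaust_6[of k] by (elim disjE) (simp_all add: hodge_def axis_def)
  then have "axis k 1 \<in> Mh"
    by (simp add: Mh_iff inner_axis_axis inner_axis')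
  moreover have "axis k 1 $ j \<noteq> 0 \<Longrightarrow> 1 * pair_sum e $ j + 0 * pair_prod e $ j = pair_sum e $ k" for j
    by (simp add: axis_def split: if_splits)
  ultimately have "critical_point e (axis k 1)"
    by (intro critical_point_if_support_on_line(1)[where a = 1 and b = 0]) (auto simp: zero_prod_def)
  moreover have "EM e (axis k 1) = (pair_sum e $ k, pair_prod e $ k)"
    by (simp add: EM_def eta1_eq_inner eta2_eq_inner inner_axis')
  ultimately show ?thesis
    unfolding critical_values_def by (intro image_eqI[where x = "axis k 1"]) auto
qed

lemma pair_point_critical_value:
  assumes "i \<in> {1..4}" "j \<in> {1..4}" "i \<noteq> j"
  shows "(e i + e j, e i * e j) \<in> critical_values e"
proof -
  have "(e i + e j, e i * e j) \<in> range (\<lambda>k. (pair_sum e $ k, pair_prod e $ k))"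
  proof -
    have "i \<in> {1, 2, 3, 4}" "j \<in> {1, 2, 3, 4}" using assms(1,2) by auto
    then show ?thesis
      using assms(3) by (elim insertE emptyE) (simp_all add: UNIV_6 pair_sum_def pair_prod_def add.commute mult.commute)
  qed
  then obtain k where "(e i + e j, e i * e j) = (pair_sum e $ k, pair_prod e $ k)" by blast
  then show ?thesis using weight_critical_value[of e k] by simp
qed

lemma Ccurve_subset_critical_values:
  assumes "e 1 < e 2" "e 2 < e 3" "e 3 < e 4"
  shows "Ccurve e \<subseteq> critical_values e"
proof
  fix z assume "z \<in> Ccurve e"
  then obtain t where z: "z = (2 * t, t\<^sup>2)" and t: "e 2 \<le> t" "t \<le> e 3"
    unfolding Ccurve_def by blast
  define y1 y2 y3 y4 where "y1 = sqrt (t - e 1)" "y2 = sqrt (t - e 2)" "y3 = sqrt (e 3 - t)" "y4 = sqrt (e 4 - t)"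
  define r where "r = 1 / sqrt ((e 4 - e 1) * (e 3 - e 2))"
  have y: "y1\<^sup>2 = t - e 1" "y2\<^sup>2 = t - e 2" "y3\<^sup>2 = e 3 - t" "y4\<^sup>2 = e 4 - t"
    using assms t by (simp_all add: y1_y2_y3_y4_def)
  have r: "r\<^sup>2 * ((e 4 - e 1) * (e 3 - e 2)) = 1"
    using assms by (simp add: r_def power_divide)
  text \<open>l_ij \<propto> y_i y_j on the four pairs other than {1, 4}, {2, 3}, with y_i = \<surd>|t - e_i|;
    the multipliers are (a, b, c, d) = (-t, 1, -t^2, y_1 y_2 y_3 y_4).\<close>
  define p where "p = vec6 (y1 * y2 * r) (y1 * y3 * r) 0 0 (y2 * y4 * r) (y3 * y4 * r)"
  have "p \<in> Mh"
    using y r by (simp add: Mh_def casimirs_def p_def) algebra+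
  moreover have "(- t) *\<^sub>R (pair_sum e * p) + 1 *\<^sub>R (pair_prod e * p)
      = (- t\<^sup>2) *\<^sub>R p + (y1 * y2 * y3 * y4) *\<^sub>R hodge p"
    using y by (simp add: vec_eq_iff forall_6 p_def pair_sum_def pair_prod_def hodge_def) algebra+
  ultimately have "critical_point e p"
    unfolding critical_point_iff by (metis prod.inject zero_neq_one zero_prod_def)
  moreover have "EM e p = z"
    using y r unfolding z by (simp add: EM_def eta1_def eta2_def p_def) algebra+
  ultimately show "z \<in> critical_values e"
    unfolding critical_values_def by blast
qed

lemma closed_segment_subset_critical_values_Lline:
  assumes "\<And>u. 0 \<le> u \<Longrightarrow> u \<le> 1 \<Longrightarrow> q u \<in> Mh"
    and "\<And>u. 0 \<le> u \<Longrightarrow> u \<le> 1 \<Longrightarrow> EM e (q u) = (1 - u) *\<^sub>R w1 + u *\<^sub>R w2"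
    and "\<And>u. \<forall>k. q u $ k \<noteq> 0 \<longrightarrow> (pair_sum e $ k, pair_prod e $ k) \<in> Lline e i"
  shows "closed_segment w1 w2 \<subseteq> critical_values e \<inter> Lline e i"
proof
  fix z assume "z \<in> closed_segment w1 w2"
  then obtain u where u: "0 \<le> u" "u \<le> 1" and z: "z = EM e (q u)"
    using assms(2) unfolding closed_segment_def by auto
  have "q u $ k \<noteq> 0 \<Longrightarrow> (- e i) * pair_sum e $ k + 1 * pair_prod e $ k = - (e i)\<^sup>2" for k
    using assms(3) by (auto simp: Lline_def algebra_simps power2_eq_square)
  then have "critical_point e (q u)" "(- e i) * eta1 e (q u) + 1 * eta2 e (q u) = - (e i)\<^sup>2"
    using critical_point_if_support_on_line[of "q u" "- e i" 1] assms(1)[OF u] by (auto simp: zero_prod_def)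
  then show "z \<in> critical_values e \<inter> Lline e i"
    unfolding z critical_values_def by (auto simp: EM_def Lline_def algebra_simps power2_eq_square)
qed

lemma infinite_critical_values_Lline:
  assumes "e 1 < e 2" "e 2 < e 3" "e 3 < e 4" "i \<in> {1..4}"
  shows "infinite (critical_values e \<inter> Lline e i)"
proof -
  have segment: "infinite (critical_values e \<inter> Lline e i)"
    if "v \<noteq> w" and "\<And>u. 0 \<le> u \<Longrightarrow> u \<le> 1 \<Longrightarrow> q u \<in> Mh"
      and "\<And>u. 0 \<le> u \<Longrightarrow> u \<le> 1 \<Longrightarrow> EM e (q u) = (1 - u) *\<^sub>R v + u *\<^sub>R w"
      and "\<And>u. \<forall>k. q u $ k \<noteq> 0 \<longrightarrow> (pair_sum e $ k, pair_prod e $ k) \<in> Lline e i" for q v w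
  proof (rule infinite_super)
    show "closed_segment v w \<subseteq> critical_values e \<inter> Lline e i"
      by (rule closed_segment_subset_critical_values_Lline[where q = q]) (fact that)+
  qed (use that(1) in simp)
  note defs = Mh_def casimirs_def EM_def eta1_def eta2_def forall_6 pair_sum_def pair_prod_def Lline_def
  have "i \<in> {1, 2, 3, 4}" using assms(4) by auto
  then show ?thesis
  proof (elim insertE emptyE)
    assume "i = 1"
    show ?thesis
      by (rule segment[where v = "(e 1 + e 4, e 1 * e 4)" and w = "(e 1 + e 2, e 1 * e 2)"
            and q = "\<lambda>u. vec6 0 0 0 (sqrt (1 - u)) 0 (sqrt u)"])
        (use assms \<open>i = 1\<close> in \<open>simp_all add: defs algebra_simps\<close>)
  next
    assume "i = 2"
    show ?thesis
      by (rule segment[where v = "(e 2 + e 4, e 2 * e 4)" and w = "(e 2 + e 3, e 2 * e 3)"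
            and q = "\<lambda>u. vec6 0 (sqrt (1 - u)) (sqrt u) 0 0 0"])
        (use assms \<open>i = 2\<close> in \<open>simp_all add: defs algebra_simps\<close>)
  next
    assume "i = 3"
    show ?thesis
      by (rule segment[where v = "(e 3 + e 4, e 3 * e 4)" and w = "(e 2 + e 3, e 2 * e 3)"
            and q = "\<lambda>u. vec6 (sqrt (1 - u)) 0 (sqrt u) 0 0 0"])
        (use assms \<open>i = 3\<close> in \<open>simp_all add: defs algebra_simps\<close>)
  next
    assume "i = 4"
    show ?thesis
      by (rule segment[where v = "(e 3 + e 4, e 3 * e 4)" and w = "(e 2 + e 4, e 2 * e 4)"
            and q = "\<lambda>u. vec6 (sqrt (1 - u)) (sqrt u) 0 0 0 0"])
        (use assms \<open>i = 4\<close> in \<open>simp_all add: defs algebra_simps\<close>)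
  qed
qed

lemma Lline_Int_Lline:
  assumes "e i \<noteq> e j"
  shows "Lline e i \<inter> Lline e j = {(e i + e j, e i * e j)}"
proof (intro equalityI subsetI)
  fix z assume "z \<in> Lline e i \<inter> Lline e j"
  then obtain x y where z: "z = (x, y)" and "y - e i * (x - e i) = 0" "y - e j * (x - e j) = 0"
    unfolding Lline_def by auto
  then have "(e i - e j) * (x - (e i + e j)) = 0" by (simp add: algebra_simps)
  then have "x = e i + e j" using assms by simp
  then show "z \<in> {(e i + e j, e i * e j)}"
    using z \<open>y - e i * (x - e i) = 0\<close> by (simp add: algebra_simps)
qed (auto simp: Lline_def algebra_simps)

lemma Lline_Int_parabola: "Lline e i \<inter> parabola = {(2 * e i, (e i)\<^sup>2)}"
proof (intro equalityI subsetI)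
  fix z assume "z \<in> Lline e i \<inter> parabola"
  then obtain x y where z: "z = (x, y)" and "y - e i * (x - e i) = 0" and y: "y = x\<^sup>2 / 4"
    unfolding Lline_def parabola_def by auto
  then have "(x / 2 - e i)\<^sup>2 = 0" by (simp add: algebra_simps power2_eq_square)
  then have "x = 2 * e i" by simp
  then show "z \<in> {(2 * e i, (e i)\<^sup>2)}" using z y by (simp add: power2_eq_square)
qed (auto simp: Lline_def parabola_def algebra_simps power2_eq_square)

lemma Lline_Int_Ccurve:
  assumes "e 2 \<le> e i" "e i \<le> e 3"
  shows "Lline e i \<inter> Ccurve e = {(2 * e i, (e i)\<^sup>2)}"
proof -
  have "Ccurve e \<subseteq> parabola"
    by (auto simp: Ccurve_def parabola_def power2_eq_square)
  moreover have "(2 * e i, (e i)\<^sup>2) \<in> Ccurve e"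
    using assms unfolding Ccurve_def by blast
  ultimately show ?thesis
    using Lline_Int_parabola[of e i] by blast
qed

theorem proposition3:
  fixes e :: "nat \<Rightarrow> real"
  assumes "e 1 < e 2" and "e 2 < e 3" and "e 3 < e 4"
  shows "critical_values e \<subseteq> (\<Union>i\<in>{1..4}. Lline e i) \<union> Ccurve e
    \<and> (\<forall>i\<in>{1..4}. infinite (critical_values e \<inter> Lline e i))
    \<and> Ccurve e \<subseteq> critical_values e
    \<and> (\<forall>i\<in>{1..4}. \<forall>j\<in>{1..4}. i \<noteq> j \<longrightarrow>
           Lline e i \<inter> Lline e j = {(e i + e j, e i * e j)} \<and> e i \<noteq> e j
           \<and> (e i + e j, e i * e j) \<in> critical_values e)
    \<and> (\<forall>i\<in>{2,3}. Lline e i \<inter> Ccurve e = {(2 * e i, (e i)^2)}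
           \<and> Lline e i \<inter> parabola = {(2 * e i, (e i)^2)})"
proof -
  have e_inj: "e i \<noteq> e j" if "i \<in> {1..4}" "j \<in> {1..4}" "i \<noteq> j" for i j
  proof -
    have "i \<in> {1, 2, 3, 4}" "j \<in> {1, 2, 3, 4}" using that(1,2) by auto
    then show ?thesis using that(3) assms by (elim insertE emptyE) simp_all
  qed
  have "e 2 \<le> e i \<and> e i \<le> e 3" if "i \<in> {2, 3}" for i
    using that assms by auto
  then show ?thesis
    using critical_values_subset[OF assms] infinite_critical_values_Lline[OF assms]
      Ccurve_subset_critical_values[OF assms] Lline_Int_Lline[OF e_inj] e_inj
      pair_point_critical_value Lline_Int_Ccurve Lline_Int_parabola
    by simp
qed

end
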